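(* Let $X$ be a set, $K$ an integral domain, and $f$ a function assigning to each $(x,y)\in X\times X$ a value $f[xy]\in K$ with $f[xy]=-f[yx]$ and $f[xx]=0$. Then the following are equivalent. (i) For every even $n\ge0$ and all $x_1,\ldots,x_n\in X$, $$f[x_1\ldots x_n]=\prod_{1\le i<j\le n}f[x_ix_j].$$ (ii) For all $w,x,y,z\in X$, $$f[wx]f[yz]-f[wy]f[xz]+f[wz]f[xy]=f[wx]f[wy]f[wz]f[xy]f[xz]f[yz].$$ (The left-hand side of (ii) is the Pfaffian $f[wxyz]$.)
   Context: Words and sign. A word is a finite sequence of elements (letters) of $X$. For words $\alpha,\beta$, the word $\alpha\setminus\beta$ is obtained from $\alpha$ by deleting every letter that occurs in $\beta$. Set $s(\alpha,\beta)=0$ if $\alpha$ or $\beta$ has a repeated letter, or if $\beta$ contains a letter not in $\alpha$. Otherwise $s(\alpha,\beta)$ is the sign of the permutation rearranging $\alpha$ into $\beta(\alpha\setminus\beta)$. Pfaffian. For a word $\alpha=x_1\ldots x_{2m}$ with distinct letters, $$f[\alpha]=\sum s(\alpha,y_1\ldots y_{2m})\,f[y_1y_2]\cdots f[y_{2m-1}y_{2m}],$$ where the sum is over all partitions of $\{x_1,\ldots,x_{2m}\}$ into pairs $\{y_1,y_2\},\ldots,\{y_{2m-1},y_{2m}\}$. The summand is independent of the listing. Further conventions: $f[\epsilon]=1$, and $f[\alpha]=0$ if $\alpha$ has a repeated letter. *)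

theory Defs
  imports "HOL-Combinatorics.Permutations"
begin

definition word_minus :: "'a list \<Rightarrow> 'a list \<Rightarrow> 'a list" where
  "word_minus \<alpha> \<beta> = filter (\<lambda>x. x \<notin> set \<beta>) \<alpha>"

definition pos :: "'a list \<Rightarrow> 'a \<Rightarrow> nat" where
  "pos \<alpha> x = (LEAST i. i < length \<alpha> \<and> \<alpha> ! i = x)"

text \<open>s(alpha,beta): sign of the permutation rearranging alpha into beta(alpha minus beta);
  position i of the rearranged word holds the letter at position p i of alpha.\<close>
definition word_sign :: "'a list \<Rightarrow> 'a list \<Rightarrow> int" where
  "word_sign \<alpha> \<beta> =
     (if \<not> distinct \<alpha> \<or> \<not> distinct \<beta> \<or> \<not> set \<beta> \<subseteq> set \<alpha> then 0
      else sign (\<lambda>i. if i < length \<alpha> then pos \<alpha> ((\<beta> @ word_minus \<alpha> \<beta>) ! i) else i))"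

definition pairings :: "'a set \<Rightarrow> 'a set set set" where
  "pairings S = {M. \<Union>M = S \<and> (\<forall>p\<in>M. card p = 2) \<and> pairwise disjnt M}"

definition is_listing :: "'a set set \<Rightarrow> 'a list \<Rightarrow> bool" where
  "is_listing M ys \<longleftrightarrow> distinct ys \<and> even (length ys) \<and>
     M = {{ys ! (2*i), ys ! (2*i+1)} | i. i < length ys div 2}"

definition pf_summand :: "('a \<Rightarrow> 'a \<Rightarrow> 'k::comm_ring_1) \<Rightarrow> 'a list \<Rightarrow> 'a list \<Rightarrow> 'k" where
  "pf_summand f \<alpha> ys = of_int (word_sign \<alpha> ys) * (\<Prod>i<length ys div 2. f (ys ! (2*i)) (ys ! (2*i+1)))"

text \<open>Pfaffian f[alpha]: sum over all pairings of the letters of alpha (summand evaluated at an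
  arbitrary listing of the pairing); 0 if alpha has a repeated letter; f[epsilon] = 1
  (the empty word has exactly the empty pairing).\<close>
definition pfaff :: "('a \<Rightarrow> 'a \<Rightarrow> 'k::comm_ring_1) \<Rightarrow> 'a list \<Rightarrow> 'k" where
  "pfaff f \<alpha> = (if distinct \<alpha> then
      (\<Sum>M\<in>pairings (set \<alpha>). pf_summand f \<alpha> (SOME ys. is_listing M ys)) else 0)"

end

theory Submission
  imports Defs "HOL-Computational_Algebra.Polynomial_Factorial"
begin

text \<open>
  For an antisymmetric \<open>h\<close> let \<open>P\<^sub>h(\<alpha>) = \<Prod>i<j. h \<alpha>\<^sub>i \<alpha>\<^sub>j\<close>. Since \<open>P\<^sub>h(\<beta>) = s(\<alpha>,\<beta>) P\<^sub>h(\<alpha>)\<close>,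
  the product \<open>P\<^sub>h(\<alpha>) f[\<alpha>]\<close> is a sum over pairings without signs, which can be expanded along
  any letter.

  If \<open>f[wx] = 0\<close> for two distinct letters of \<open>\<alpha>\<close>, then (ii) says that the rows of \<open>w\<close> and \<open>x\<close> have
  vanishing minors, and expanding along \<open>w\<close> and \<open>x\<close> gives \<open>f[\<alpha>] = 0\<close>. Otherwise take
  \<open>h = 1/f\<close> in the fraction field. By induction the expansion reduces (i) to
  \<open>\<Sum>b\<in>B. \<Prod>c\<in>B-b. h w c * h b c = 1\<close> for odd \<open>card B\<close>. Write \<open>B = \<alpha> \<union> T\<close> with \<open>card T = 3\<close> and
  \<open>A = \<alpha> \<union> {w}\<close>. Evaluating
  \<open>\<Sum>a\<in>A. \<Sum>b\<in>B. (\<Prod>c\<in>A-a. h a c) * f a b * (\<Prod>c\<in>B-b. h b c)\<close> by rows and by columns, where only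
  \<open>a = w\<close> and \<open>b \<in> T\<close> contribute, reduces this to the same identity for \<open>T\<close>, which is (ii).
\<close>

subsection \<open>Ordered products and signs of words\<close>

fun prod_ordered :: "('a \<Rightarrow> 'a \<Rightarrow> 'k::comm_ring_1) \<Rightarrow> 'a list \<Rightarrow> 'k" where
  "prod_ordered h [] = 1"
| "prod_ordered h (x # xs) = (\<Prod>y\<leftarrow>xs. h x y) * prod_ordered h xs"

text \<open>Links the recursive form, suited to induction on words, with the product in (i): index
  pairs starting at 0 belong to the head, the others shift to the tail.\<close>

lemma prod_ordered_conv_prod:
  "prod_ordered h xs = (\<Prod>(i, j)\<in>{(i, j). i < j \<and> j < length xs}. h (xs ! i) (xs ! j))"
proof (induction xs)
  case Nil
  show ?case by simp
next
  case (Cons x xs)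
  let ?I = "{(i, j). i < j \<and> j < length xs}"
  have fin: "finite ?I"
    by (rule finite_subset[of _ "{..<length xs} \<times> {..<length xs}"]) auto
  have split: "{(i, j). i < j \<and> j < length (x # xs)} =
      (\<lambda>j. (0, Suc j)) ` {..<length xs} \<union> (\<lambda>(i, j). (Suc i, Suc j)) ` ?I" (is "?L = ?R")
  proof (rule set_eqI)
    fix u :: "nat \<times> nat"
    obtain i j where u: "u = (i, j)" by (cases u)
    show "u \<in> ?L \<longleftrightarrow> u \<in> ?R"
      unfolding u by (cases i; cases j) auto
  qed
  have "(\<Prod>(i, j)\<in>{(i, j). i < j \<and> j < length (x # xs)}. h ((x # xs) ! i) ((x # xs) ! j))
      = (\<Prod>(i, j)\<in>(\<lambda>j. (0, Suc j)) ` {..<length xs}. h ((x # xs) ! i) ((x # xs) ! j))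
      * (\<Prod>(i, j)\<in>(\<lambda>(i, j). (Suc i, Suc j)) ` ?I. h ((x # xs) ! i) ((x # xs) ! j))"
    unfolding split by (rule prod.union_disjoint) (use fin in auto)
  also have "\<dots> = (\<Prod>j<length xs. h x (xs ! j)) * prod_ordered h xs"
    unfolding Cons.IH
    by (subst (1 2) prod.reindex) (auto simp: inj_on_def case_prod_unfold)
  also have "(\<Prod>j<length xs. h x (xs ! j)) = (\<Prod>y\<leftarrow>xs. h x y)"
    by (induction xs) (simp_all add: prod.lessThan_Suc_shift del: prod.lessThan_Suc)
  finally show ?case by simp
qed

lemma prod_ordered_append:
  "prod_ordered h (xs @ ys) =
     prod_ordered h xs * (\<Prod>x\<leftarrow>xs. \<Prod>y\<leftarrow>ys. h x y) * prod_ordered h ys"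
  by (induction xs) (simp_all add: mult_ac)

lemma prod_list_mult_distrib:
  "(\<Prod>x\<leftarrow>xs. g x * h x) = (\<Prod>x\<leftarrow>xs. g x) * (\<Prod>x\<leftarrow>xs. h x :: 'k::comm_monoid_mult)"
  by (induction xs) (simp_all add: mult_ac)

section \<open>Ordered products under permutation of the letters\<close>

lemma antisym_mult_flip:
  fixes h :: "'a \<Rightarrow> 'a \<Rightarrow> 'k::comm_ring_1"
  assumes "\<And>x y. h x y = - h y x"
  shows "h a b * h c d = h b a * h d c"
  by (metis assms minus_mult_minus)

text \<open>A letter \<open>c\<close> between the two contributes \<open>h y c * h c x\<close>,
  which equals \<open>h x c * h c y\<close> because two signs change at once. The factors involving
  \<open>us\<close> and \<open>vs\<close> are merely reordered, so only \<open>h x y\<close> changes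
  sign.\<close>

lemma prod_ordered_swap:
  fixes h :: "'a \<Rightarrow> 'a \<Rightarrow> 'k::comm_ring_1"
  assumes anti: "\<And>x y. h x y = - h y x"
  shows "prod_ordered h (us @ y # ms @ x # vs) = - prod_ordered h (us @ x # ms @ y # vs)"
proof -
  define R where "R = prod_ordered h us * prod_ordered h ms * prod_ordered h vs *
    (\<Prod>u\<leftarrow>us. h u x) * (\<Prod>u\<leftarrow>us. h u y) * (\<Prod>u\<leftarrow>us. \<Prod>c\<leftarrow>ms. h u c) *
    (\<Prod>u\<leftarrow>us. \<Prod>v\<leftarrow>vs. h u v) * (\<Prod>c\<leftarrow>ms. \<Prod>v\<leftarrow>vs. h c v) *
    (\<Prod>v\<leftarrow>vs. h x v) * (\<Prod>v\<leftarrow>vs. h y v)"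
  have "prod_ordered h (us @ y # ms @ x # vs) = (\<Prod>c\<leftarrow>ms. h y c * h c x) * h y x * R"
    by (simp add: R_def prod_ordered_append prod_list_mult_distrib mult_ac)
  also have "(\<Prod>c\<leftarrow>ms. h y c * h c x) = (\<Prod>c\<leftarrow>ms. h x c * h c y)"
  proof -
    have "h y c * h c x = h x c * h c y" for c
      using antisym_mult_flip[of h, OF anti, where a = y and b = c and c = c and d = x] by (simp add: mult.commute)
    then show ?thesis by simp
  qed
  also have "h y x = - h x y" by (rule anti)
  also have "(\<Prod>c\<leftarrow>ms. h x c * h c y) * - h x y * R
      = - prod_ordered h (us @ x # ms @ y # vs)"
    by (simp add: R_def prod_ordered_append prod_list_mult_distrib mult_ac)
  finally show ?thesis .
qed

lemma permute_list_transpose_decomp: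
  assumes "a < b" "b < length xs"
  obtains us x ms y vs where "xs = us @ x # ms @ y # vs"
    "permute_list (transpose a b) xs = us @ y # ms @ x # vs"
proof -
  define us ms vs where "us = take a xs" and "ms = take (b - a - 1) (drop (Suc a) xs)"
    and "vs = drop (Suc b) xs"
  have "xs = us @ xs ! a # drop (Suc a) xs"
    unfolding us_def using assms by (intro id_take_nth_drop) simp
  moreover have "drop (Suc a) xs = ms @ drop (Suc a) xs ! (b - a - 1) # drop (Suc (b - a - 1)) (drop (Suc a) xs)"
    unfolding ms_def using assms by (intro id_take_nth_drop) simp
  moreover have "drop (Suc a) xs ! (b - a - 1) = xs ! b"
    "drop (Suc (b - a - 1)) (drop (Suc a) xs) = vs"
    using assms by (simp_all add: vs_def)
  ultimately have xs: "xs = us @ xs ! a # ms @ xs ! b # vs"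
    by simp
  have len: "length us = a" "length ms = b - a - 1"
    using assms by (auto simp: us_def ms_def)
  have "permute_list (transpose a b) xs = xs[a := xs ! b, b := xs ! a]"
    by (rule nth_equalityI)
      (use assms in \<open>auto simp: permute_list_def nth_list_update transpose_def\<close>)
  also have "\<dots> = (us @ xs ! a # ms @ xs ! b # vs)[a := xs ! b, b := xs ! a]"
    using xs by simp
  also have "\<dots> = us @ xs ! b # ms @ xs ! a # vs"
  proof -
    have "b - a = Suc (length ms)" using len assms by simp
    then show ?thesis using len assms(1) by (simp add: list_update_append)
  qed
  finally show ?thesis using xs that by blast
qed

text \<open>A permutation is built up from transpositions, and each of them negates the
  product.\<close>

lemma prod_ordered_permute_list:
  fixes h :: "'a \<Rightarrow> 'a \<Rightarrow> 'k::comm_ring_1"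
  assumes anti: "\<And>x y. h x y = - h y x" and p: "p permutes {..<length xs}"
  shows "prod_ordered h (permute_list p xs) = of_int (sign p) * prod_ordered h xs"
proof -
  have flip: "prod_ordered h (permute_list (transpose a b) ys) = - prod_ordered h ys"
    if ab: "a < b" "b < length ys" for a b and ys :: "'a list"
  proof -
    obtain us x ms y vs where "ys = us @ x # ms @ y # vs"
      "permute_list (transpose a b) ys = us @ y # ms @ x # vs"
      by (rule permute_list_transpose_decomp[OF ab])
    then show ?thesis using prod_ordered_swap[of h, OF anti, of us y ms x vs] by simp
  qed
  have "finite {..<length xs}" by simp
  from this p show ?thesis
  proof (induction p rule: permutes_rev_induct)
    case id
    then show ?case by (simp add: sign_id)
  next
    case (swap a b p)
    have t: "transpose a b permutes {..<length xs}"
      using swap.hyps by (simp add: permutes_swap_id)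
    have "prod_ordered h (permute_list (p \<circ> transpose a b) xs)
        = prod_ordered h (permute_list (transpose a b) (permute_list p xs))"
      by (simp add: permute_list_compose[OF t])
    also have "\<dots> = - prod_ordered h (permute_list p xs)"
      using flip[of a b "permute_list p xs"] flip[of b a "permute_list p xs"] swap.hyps
      by (cases a b rule: linorder_cases) (auto simp: transpose_commute)
    also have "\<dots> = of_int (sign (p \<circ> transpose a b)) * prod_ordered h xs"
    proof -
      have "permutation p" using swap.hyps permutation_permutes by blast
      with swap.hyps swap.IH show ?thesis
        by (simp add: sign_compose sign_swap_id permutation_swap_id)
    qed
    finally show ?case .
  qed
qed

lemma pos_less_length_nth:
  assumes "x \<in> set xs"
  shows "pos xs x < length xs" and "xs ! pos xs x = x"
proof -
  obtain i where "i < length xs \<and> xs ! i = x"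
    using assms by (auto simp: in_set_conv_nth)
  then have "pos xs x < length xs \<and> xs ! pos xs x = x"
    unfolding pos_def by (rule LeastI)
  then show "pos xs x < length xs" "xs ! pos xs x = x" by auto
qed

lemma pos_nth:
  assumes "distinct xs" "i < length xs"
  shows "pos xs (xs ! i) = i"
  using pos_less_length_nth[of "xs ! i" xs] assms by (simp add: nth_eq_iff_index_eq)

text \<open>This absorbs the signs: as \<open>ys\<close> uses all letters of \<open>xs\<close>,
  \<open>word_minus\<close> leaves nothing over, and the permutation \<open>p\<close> inside
  \<open>word_sign\<close> satisfies \<open>permute_list p xs = ys\<close>.\<close>

lemma word_sign_mult_prod_ordered:
  fixes h :: "'a \<Rightarrow> 'a \<Rightarrow> 'k::comm_ring_1"
  assumes anti: "\<And>x y. h x y = - h y x"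
    and "distinct xs" "distinct ys" "set ys = set xs"
  shows "of_int (word_sign xs ys) * prod_ordered h xs = prod_ordered h ys"
proof -
  define p where "p i = (if i < length xs then pos xs (ys ! i) else i)" for i
  have len: "length ys = length xs"
    using assms by (metis distinct_card)
  have posin: "pos xs (ys ! i) < length xs" "xs ! pos xs (ys ! i) = ys ! i"
    if "i < length xs" for i
    using that len assms(4) nth_mem[of i ys] pos_less_length_nth[of "ys ! i" xs] by simp_all
  have minus: "word_minus xs ys = []"
    using assms by (simp add: word_minus_def filter_empty_conv)
  then have sgn: "word_sign xs ys = sign p"
    using assms(2-4) unfolding word_sign_def p_def[abs_def] minus append_Nil2 by simp
  have "inj_on p {..<length xs}"
  proof (rule inj_onI)
    fix i j assume "i \<in> {..<length xs}" "j \<in> {..<length xs}" "p i = p j"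
    then have "ys ! i = ys ! j" using posin by (metis lessThan_iff p_def)
    then show "i = j"
      using \<open>i \<in> _\<close> \<open>j \<in> _\<close> assms(3) len by (simp add: nth_eq_iff_index_eq)
  qed
  moreover have "p ` {..<length xs} \<subseteq> {..<length xs}"
    using posin by (auto simp: p_def)
  ultimately have "bij_betw p {..<length xs} {..<length xs}"
    by (simp add: bij_betw_def endo_inj_surj)
  then have perm: "p permutes {..<length xs}"
    by (rule bij_imp_permutes) (simp add: p_def)
  have "permute_list p xs = ys"
    by (rule nth_equalityI) (use len posin in \<open>auto simp: permute_list_def p_def\<close>)
  then show ?thesis
    using prod_ordered_permute_list[of h, OF anti perm] sgn by simp
qed

subsection \<open>Pfaffians as sums over pairings without signs\<close>

text \<open>Recursive counterpart of the indexed blocks in \<open>is_listing\<close>. An unpaired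
  last letter is ignored, so statements about the union of the blocks need even length.\<close>

fun pair_blocks :: "'a list \<Rightarrow> 'a set set" where
  "pair_blocks (x # y # zs) = insert {x, y} (pair_blocks zs)"
| "pair_blocks _ = {}"

fun pair_prod :: "('a \<Rightarrow> 'a \<Rightarrow> 'k::comm_ring_1) \<Rightarrow> 'a list \<Rightarrow> 'k" where
  "pair_prod f (x # y # zs) = f x y * pair_prod f zs"
| "pair_prod f _ = 1"

lemma pair_blocks_conv_nth:
  "{{ys ! (2*i), ys ! (2*i+1)} | i. i < length ys div 2} = pair_blocks ys"
proof (induction ys rule: pair_blocks.induct)
  case (1 x y zs)
  let ?b = "\<lambda>ys i. {ys ! (2*i), ys ! (2*i+1)}"
  have "{?b (x # y # zs) i | i. i < length (x # y # zs) div 2}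
      = ?b (x # y # zs) ` {..<Suc (length zs div 2)}"
    by auto
  also have "\<dots> = insert {x, y} (?b zs ` {..<length zs div 2})"
    by (simp add: lessThan_Suc_eq_insert_0 image_image)
  also have "?b zs ` {..<length zs div 2} = {?b zs i | i. i < length zs div 2}"
    by auto
  finally show ?case using 1 by simp
qed auto

lemma pair_prod_conv_nth:
  "(\<Prod>i<length ys div 2. f (ys ! (2*i)) (ys ! (2*i+1))) = pair_prod f ys"
  by (induction f ys rule: pair_prod.induct)
    (simp_all add: prod.lessThan_Suc_shift del: prod.lessThan_Suc)

lemma is_listing_iff:
  "is_listing M ys \<longleftrightarrow> distinct ys \<and> even (length ys) \<and> M = pair_blocks ys"
  unfolding is_listing_def pair_blocks_conv_nth ..

lemma pair_blocks_append:
  "even (length us) \<Longrightarrow> pair_blocks (us @ vs) = pair_blocks us \<union> pair_blocks vs"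
  by (induction us rule: pair_blocks.induct) auto

lemma pair_prod_append:
  "even (length us) \<Longrightarrow> pair_prod f (us @ vs) = pair_prod f us * pair_prod f vs"
  by (induction f us rule: pair_prod.induct) (auto simp: mult_ac)

lemma Union_pair_blocks: "even (length ys) \<Longrightarrow> \<Union> (pair_blocks ys) = set ys"
  by (induction ys rule: pair_blocks.induct) auto

lemma pair_blocks_subset: "X \<in> pair_blocks ys \<Longrightarrow> X \<subseteq> set ys"
  by (induction ys rule: pair_blocks.induct) auto

lemma pair_blocks_split:
  assumes "X \<in> pair_blocks ys"
  obtains us p q vs where "ys = us @ p # q # vs" "even (length us)" "X = {p, q}"
  using assms
proof (induction ys arbitrary: thesis rule: pair_blocks.induct)
  case (1 x y zs)
  show ?case
  proof (cases "X = {x, y}")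
    case True
    then show ?thesis using "1.prems"(1)[of "[]" x y zs] by simp
  next
    case False
    then have "X \<in> pair_blocks zs" using "1.prems"(2) by simp
    with "1.IH" obtain us p q vs where "zs = us @ p # q # vs" "even (length us)" "X = {p, q}"
      by metis
    then show ?thesis using "1.prems"(1)[of "x # y # us" p q vs] by simp
  qed
qed auto

definition pairing_weight :: "('a \<Rightarrow> 'a \<Rightarrow> 'k::comm_ring_1) \<Rightarrow> ('a \<Rightarrow> 'a \<Rightarrow> 'k) \<Rightarrow> 'a list \<Rightarrow> 'k" where
  "pairing_weight f h ys = prod_ordered h ys * pair_prod f ys"

text \<open>A letter \<open>u\<close> before the pair meets it through \<open>h u p * h u q\<close>;
  flipping both factors costs no sign, so letters before and after the pair contribute
  alike.\<close>

lemma pairing_weight_remove_pair: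
  fixes h :: "'a \<Rightarrow> 'a \<Rightarrow> 'k::comm_ring_1"
  assumes anti: "\<And>x y. h x y = - h y x" and "even (length us)"
  shows "pairing_weight f h (us @ p # q # vs) =
    f p q * h p q * (\<Prod>c\<leftarrow>us @ vs. h p c * h q c) * pairing_weight f h (us @ vs)"
proof -
  have "h u p * h u q = h p u * h q u" for u
    by (rule antisym_mult_flip[of h, OF anti])
  then have "(\<Prod>u\<leftarrow>us. h u p) * (\<Prod>u\<leftarrow>us. h u q) = (\<Prod>u\<leftarrow>us. h p u * h q u)"
    by (simp add: prod_list_mult_distrib[symmetric])
  moreover have "prod_ordered h (us @ p # q # vs) =
      ((\<Prod>u\<leftarrow>us. h u p) * (\<Prod>u\<leftarrow>us. h u q)) * h p q *
      (\<Prod>c\<leftarrow>vs. h p c * h q c) * prod_ordered h (us @ vs)"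
    by (simp add: prod_ordered_append prod_list_mult_distrib mult_ac)
  ultimately show ?thesis
    using assms(2) by (simp add: pairing_weight_def pair_prod_append mult_ac)
qed

text \<open>The first pair of \<open>ys\<close> occurs somewhere in \<open>zs\<close>. Splitting it
  off leaves two listings of the same smaller pairing, and the factor split off is symmetric in
  \<open>p\<close> and \<open>q\<close> because \<open>f p q\<close> and \<open>h p q\<close> change
  sign together.\<close>

lemma pairing_weight_listing_unique:
  fixes f h :: "'a \<Rightarrow> 'a \<Rightarrow> 'k::comm_ring_1"
  assumes f: "\<And>x y. f x y = - f y x" and h: "\<And>x y. h x y = - h y x"
    and "is_listing M ys" "is_listing M zs"
  shows "pairing_weight f h ys = pairing_weight f h zs"
  using assms(3-)
proof (induction ys arbitrary: M zs rule: pair_blocks.induct)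
  case (1 p q ys)
  have ys: "distinct (p # q # ys)" "even (length ys)" "M = pair_blocks (p # q # ys)"
    using "1.prems"(1) by (auto simp: is_listing_iff)
  have zs: "distinct zs" "even (length zs)" "M = pair_blocks zs"
    using "1.prems"(2) by (auto simp: is_listing_iff)
  have "{p, q} \<in> pair_blocks zs" using ys zs by auto
  then obtain us p' q' vs where zs': "zs = us @ p' # q' # vs" "even (length us)" "{p, q} = {p', q'}"
    by (rule pair_blocks_split)
  have vs: "even (length (us @ vs))" "distinct (us @ vs)" using zs zs' by auto
  have "{p, q} \<notin> pair_blocks ys" using pair_blocks_subset[of "{p, q}" ys] ys(1) by auto
  then have 1: "pair_blocks ys = M - {{p, q}}" using ys(3) by auto
  have "{p', q'} \<notin> pair_blocks (us @ vs)"
    using pair_blocks_subset[of "{p', q'}" "us @ vs"] zs(1) zs'(1) by auto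
  then have "pair_blocks (us @ vs) = M - {{p', q'}}"
    using zs(3) zs' by (auto simp: pair_blocks_append)
  with 1 zs'(3) have eq: "pair_blocks ys = pair_blocks (us @ vs)" by simp
  then have set: "set ys = set (us @ vs)"
    using Union_pair_blocks ys(2) vs(1) by metis
  have IH: "pairing_weight f h ys = pairing_weight f h (us @ vs)"
    by (rule "1.IH"[of "pair_blocks ys"]) (use ys vs eq in \<open>auto simp: is_listing_iff\<close>)
  have "(\<Prod>c\<leftarrow>ys. h p c * h q c) = (\<Prod>c\<in>set ys. h p c * h q c)"
    using ys(1) by (simp add: prod.distinct_set_conv_list)
  also have "\<dots> = (\<Prod>c\<leftarrow>us @ vs. h p c * h q c)"
    unfolding set by (rule prod.distinct_set_conv_list[OF vs(2)])
  also have "\<dots> = (\<Prod>c\<leftarrow>us @ vs. h p' c * h q' c)"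
    using zs'(3) by (auto simp: doubleton_eq_iff mult.commute)
  finally have prod: "(\<Prod>c\<leftarrow>ys. h p c * h q c) = (\<Prod>c\<leftarrow>us @ vs. h p' c * h q' c)" .
  have "f p q * h p q = f q p * h q p" using f[of p q] h[of p q] by simp
  then have "f p q * h p q = f p' q' * h p' q'"
    using zs'(3) by (auto simp: doubleton_eq_iff)
  moreover have "pairing_weight f h (p # q # ys) =
      f p q * h p q * (\<Prod>c\<leftarrow>ys. h p c * h q c) * pairing_weight f h ys"
    using pairing_weight_remove_pair[where h = h and f = f, OF h, where us = "[]" and vs = ys] by simp
  moreover have "pairing_weight f h zs =
      f p' q' * h p' q' * (\<Prod>c\<leftarrow>us @ vs. h p' c * h q' c) * pairing_weight f h (us @ vs)"
    unfolding zs'(1) by (rule pairing_weight_remove_pair[where h = h and f = f, OF h zs'(2)])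
  ultimately show ?case
    using IH prod by simp
next
  case "2_1"
  then have "zs = []"
    by (cases zs rule: pair_blocks.cases) (auto simp: is_listing_iff)
  then show ?case by simp
next
  case ("2_2" v)
  then show ?case by (simp add: is_listing_iff)
qed

section \<open>Sums over pairings and their expansion along a letter\<close>

definition pairing_sum :: "('a \<Rightarrow> 'a \<Rightarrow> 'k::comm_ring_1) \<Rightarrow> ('a \<Rightarrow> 'a \<Rightarrow> 'k) \<Rightarrow> 'a set \<Rightarrow> 'k" where
  "pairing_sum f h S = (\<Sum>M\<in>pairings S. pairing_weight f h (SOME ys. is_listing M ys))"

text \<open>Ensures that \<open>SOME\<close> in the Pfaffian picks an actual listing: disjoint pairs
  can be prepended one by one without repeating a letter.\<close>

lemma ex_listing:
  assumes "finite M" "\<forall>p\<in>M. card p = 2" "pairwise disjnt M"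
  shows "\<exists>ys. is_listing M ys"
  using assms
proof (induction M rule: finite_induct)
  case empty
  then show ?case by (intro exI[of _ "[]"]) (simp add: is_listing_iff)
next
  case (insert X M)
  have "\<forall>p\<in>M. card p = 2" "pairwise disjnt M"
    using insert.prems by (auto simp: pairwise_insert)
  then obtain ys where ys: "is_listing M ys"
    using insert.IH by blast
  obtain p q where X: "X = {p, q}" "p \<noteq> q"
    using insert.prems(1) by (auto simp: card_2_iff)
  have "\<forall>Y\<in>M. disjnt X Y"
    using insert.prems(2) insert.hyps by (auto simp: pairwise_insert)
  then have "X \<inter> set ys = {}"
    using ys Union_pair_blocks[of ys] by (auto simp: is_listing_iff disjnt_def)
  then have "is_listing (insert X M) (p # q # ys)"
    using ys X by (auto simp: is_listing_iff)
  then show ?case by blast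
qed

lemma finite_pairing:
  assumes "finite S" "M \<in> pairings S"
  shows "finite M"
  using assms by (auto simp: pairings_def dest: finite_UnionD)

lemma listing_some:
  assumes "finite S" "M \<in> pairings S"
  defines "L \<equiv> SOME ys. is_listing M ys"
  shows "is_listing M L" and "set L = S"
proof -
  have "\<exists>ys. is_listing M ys"
    using assms finite_pairing[OF assms(1,2)] by (intro ex_listing) (auto simp: pairings_def)
  then show L: "is_listing M L" unfolding L_def by (rule someI_ex)
  then show "set L = S"
    using Union_pair_blocks[of L] assms(2) by (auto simp: is_listing_iff pairings_def)
qed

text \<open>Each sign turns into the ordered product of the chosen listing. The result depends only
  on the set of letters, which makes expansion along an arbitrary letter possible.\<close>

lemma prod_ordered_mult_pfaff:
  fixes f h :: "'a \<Rightarrow> 'a \<Rightarrow> 'k::comm_ring_1"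
  assumes h: "\<And>x y. h x y = - h y x" and "distinct xs"
  shows "prod_ordered h xs * pfaff f xs = pairing_sum f h (set xs)"
proof -
  have "prod_ordered h xs * pf_summand f xs (SOME ys. is_listing M ys) =
      pairing_weight f h (SOME ys. is_listing M ys)" if "M \<in> pairings (set xs)" for M
  proof -
    let ?L = "SOME ys. is_listing M ys"
    have "is_listing M ?L" and set: "set ?L = set xs"
      using listing_some[OF finite_set that] by auto
    then have "distinct ?L" by (simp add: is_listing_iff)
    from word_sign_mult_prod_ordered[of h, OF h \<open>distinct xs\<close> this set] show ?thesis
      unfolding pf_summand_def pair_prod_conv_nth pairing_weight_def
      by (metis mult.assoc mult.commute)
  qed
  then show ?thesis
    using \<open>distinct xs\<close> by (simp add: pfaff_def pairing_sum_def sum_distrib_left)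
qed

text \<open>A pairing of \<open>insert w B\<close> is determined by the partner \<open>b\<close> of
  \<open>w\<close> and the pairing induced on the remaining letters.\<close>

lemma bij_betw_pairings_insert:
  assumes "w \<notin> B"
  shows "bij_betw (\<lambda>(b, M). insert {w, b} M) (SIGMA b:B. pairings (B - {b}))
    (pairings (insert w B))"
proof (rule bij_betw_imageI)
  show "inj_on (\<lambda>(b, M). insert {w, b} M) (SIGMA b:B. pairings (B - {b}))"
  proof (rule inj_onI, clarify)
    fix b M c N
    assume b: "b \<in> B" "M \<in> pairings (B - {b})" and c: "c \<in> B" "N \<in> pairings (B - {c})"
      and eq: "insert {w, b} M = insert {w, c} N"
    have M: "{w, x} \<notin> M" and N: "{w, x} \<notin> N" for x
      using b c assms by (auto simp: pairings_def)
    have "{w, b} = {w, c}" using eq N by blast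
    then have "b = c" by (auto simp: doubleton_eq_iff)
    then show "b = c \<and> M = N" using eq M N by (metis insert_ident)
  qed
  show "(\<lambda>(b, M). insert {w, b} M) ` (SIGMA b:B. pairings (B - {b})) = pairings (insert w B)"
  proof (intro equalityI subsetI)
    fix M assume "M \<in> (\<lambda>(b, M). insert {w, b} M) ` (SIGMA b:B. pairings (B - {b}))"
    then obtain b N where N: "b \<in> B" "N \<in> pairings (B - {b})" "M = insert {w, b} N"
      by auto
    have "card {w, b} = 2" using N assms by (auto simp: card_2_iff)
    moreover have "\<forall>Y\<in>N. disjnt {w, b} Y"
      using N(2) assms by (auto simp: pairings_def disjnt_def)
    ultimately show "M \<in> pairings (insert w B)"
      using N assms by (auto simp: pairings_def pairwise_insert disjnt_sym)
  next
    fix M assume M: "M \<in> pairings (insert w B)"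
    then obtain X where X: "X \<in> M" "w \<in> X" "card X = 2"
      by (auto simp: pairings_def)
    then obtain b where b: "X = {w, b}" "w \<noteq> b"
      by (auto simp: card_2_iff)
    have bB: "b \<in> B" using M X b by (auto simp: pairings_def)
    have "disjnt Y X" if "Y \<in> M - {X}" for Y
      using M X that by (auto simp: pairings_def pairwise_def)
    then have "\<Union>(M - {X}) = \<Union>M - X" using X by (fastforce simp: disjnt_def)
    then have "\<Union>(M - {X}) = B - {b}"
      using M b assms by (auto simp: pairings_def)
    moreover have "pairwise disjnt (M - {X})"
      using M by (auto simp: pairings_def intro: pairwise_subset)
    ultimately have "M - {X} \<in> pairings (B - {b})"
      using M by (auto simp: pairings_def)
    moreover have "M = insert {w, b} (M - {X})" using X b by auto
    ultimately show "M \<in> (\<lambda>(b, M). insert {w, b} M) ` (SIGMA b:B. pairings (B - {b}))"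
      using bB by (intro image_eqI[of _ _ "(b, M - {X})"]) auto
  qed
qed

lemma finite_pairings: "finite S \<Longrightarrow> finite (pairings S)"
  by (rule finite_subset[of _ "Pow (Pow S)"]) (auto simp: pairings_def)

text \<open>No signs appear because moving \<open>b\<close> next to \<open>w\<close> costs the same sign in \<open>prod_ordered h\<close>.\<close>

lemma pairing_sum_insert:
  fixes f h :: "'a \<Rightarrow> 'a \<Rightarrow> 'k::comm_ring_1"
  assumes f: "\<And>x y. f x y = - f y x" and h: "\<And>x y. h x y = - h y x"
    and fin: "finite B" and w: "w \<notin> B"
  shows "pairing_sum f h (insert w B) =
    (\<Sum>b\<in>B. f w b * h w b * (\<Prod>c\<in>B - {b}. h w c * h b c) * pairing_sum f h (B - {b}))"
proof -
  let ?L = "\<lambda>M. SOME ys. is_listing M ys"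
  have step: "pairing_weight f h (?L (insert {w, b} M)) =
      f w b * h w b * (\<Prod>c\<in>B - {b}. h w c * h b c) * pairing_weight f h (?L M)"
    if b: "b \<in> B" and M: "M \<in> pairings (B - {b})" for b M
  proof -
    have L: "is_listing M (?L M)" "set (?L M) = B - {b}"
      using listing_some[OF _ M] fin by auto
    then have "is_listing (insert {w, b} M) (w # b # ?L M)"
      using b w by (auto simp: is_listing_iff)
    \<comment> \<open>The listing chosen by \<open>SOME\<close> need not begin with \<open>w\<close>
      and \<open>b\<close>, but its weight agrees with that of \<open>w # b # ?L M\<close>.\<close>
    moreover have "is_listing (insert {w, b} M) (?L (insert {w, b} M))"
      using calculation by (rule someI)
    ultimately have "pairing_weight f h (?L (insert {w, b} M)) = pairing_weight f h (w # b # ?L M)"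
      using pairing_weight_listing_unique[where f = f and h = h, OF f h] by blast
    also have "\<dots> = f w b * h w b * (\<Prod>c\<leftarrow>?L M. h w c * h b c) * pairing_weight f h (?L M)"
      using pairing_weight_remove_pair[where h = h and f = f, OF h, where us = "[]"] by simp
    also have "(\<Prod>c\<leftarrow>?L M. h w c * h b c) = (\<Prod>c\<in>B - {b}. h w c * h b c)"
      using L prod.distinct_set_conv_list[of "?L M" "\<lambda>c. h w c * h b c"]
      by (simp add: is_listing_iff)
    finally show ?thesis .
  qed
  have "pairing_sum f h (insert w B) =
      (\<Sum>(b, M)\<in>(SIGMA b:B. pairings (B - {b})). pairing_weight f h (?L (insert {w, b} M)))"
    unfolding pairing_sum_def
    using sum.reindex_bij_betw[OF bij_betw_pairings_insert[OF w],
        of "\<lambda>M. pairing_weight f h (?L M)", symmetric]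
    by (simp add: case_prod_unfold)
  also have "\<dots> = (\<Sum>b\<in>B. \<Sum>M\<in>pairings (B - {b}). pairing_weight f h (?L (insert {w, b} M)))"
    by (rule sum.Sigma[symmetric]) (use fin in \<open>auto intro: finite_pairings\<close>)
  also have "\<dots> = (\<Sum>b\<in>B. f w b * h w b * (\<Prod>c\<in>B - {b}. h w c * h b c) * pairing_sum f h (B - {b}))"
    by (intro sum.cong refl) (simp add: step pairing_sum_def sum_distrib_left)
  finally show ?thesis .
qed

lemma pairing_sum_empty:
  fixes f h :: "'a \<Rightarrow> 'a \<Rightarrow> 'k::comm_ring_1"
  shows "pairing_sum f h {} = 1"
proof -
  have *: "pairings {} = {{} :: 'a set set}"
  proof -
    have "M = {}" if "M \<in> pairings {}" for M :: "'a set set"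
      using that by (force simp: pairings_def)
    moreover have "({} :: 'a set set) \<in> pairings {}" by (simp add: pairings_def)
    ultimately show ?thesis by blast
  qed
  have "is_listing {} (SOME ys :: 'a list. is_listing {} ys)"
    by (rule someI[of _ "[]"]) (simp add: is_listing_iff)
  then have "(SOME ys :: 'a list. is_listing {} ys) = []"
    by (cases "SOME ys :: 'a list. is_listing {} ys" rule: pair_blocks.cases)
      (auto simp: is_listing_iff)
  then show ?thesis by (simp add: pairing_sum_def * pairing_weight_def)
qed

subsection \<open>Vanishing entries\<close>

text \<open>Exchanging \<open>a\<close> and \<open>b\<close> would only show that twice the sum is
  0, which is too weak in characteristic 2. The induction instead cancels the row of the new element
  against its column. The diagonal is left out, since antisymmetry alone does not make it 0.\<close>

lemma antisym_double_sum_eq_0: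
  fixes F :: "'a \<Rightarrow> 'a \<Rightarrow> 'k::comm_ring_1"
  assumes "finite C" "\<And>a b. a \<in> C \<Longrightarrow> b \<in> C \<Longrightarrow> F a b = - F b a"
  shows "(\<Sum>a\<in>C. \<Sum>b\<in>C - {a}. F a b) = 0"
  using assms
proof (induction C rule: finite_induct)
  case (insert x C)
  have "(\<Sum>b\<in>insert x C - {a}. F a b) = F a x + (\<Sum>b\<in>C - {a}. F a b)" if "a \<in> C" for a
  proof -
    have "insert x C - {a} = insert x (C - {a})" using that insert.hyps by auto
    then show ?thesis using insert.hyps by simp
  qed
  moreover have "(\<Sum>a\<in>C. \<Sum>b\<in>C - {a}. F a b) = 0"
    using insert.prems by (intro insert.IH) blast
  ultimately have "(\<Sum>a\<in>C. \<Sum>b\<in>insert x C - {a}. F a b) = (\<Sum>a\<in>C. F a x)"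
    by (simp add: sum.distrib)
  moreover have "(\<Sum>b\<in>C. F x b) = - (\<Sum>a\<in>C. F a x)"
    unfolding sum_negf[symmetric] using insert.prems by (intro sum.cong refl) blast
  ultimately show ?case
    using insert.hyps by simp
qed simp

text \<open>Expand along \<open>w\<close> with partner \<open>a\<close>, then along \<open>x\<close>
  with partner \<open>b\<close>; the partner \<open>x\<close> of \<open>w\<close> drops out as
  \<open>f w x = 0\<close>. The summand is antisymmetric in \<open>a\<close> and \<open>b\<close>:
  \<open>minor\<close> makes the part in \<open>f\<close> symmetric, and the part in
  \<open>h\<close> changes sign only through \<open>h a b\<close>.\<close>

lemma pairing_sum_eq_0:
  fixes f h :: "'a \<Rightarrow> 'a \<Rightarrow> 'k::comm_ring_1"
  assumes f: "\<And>x y. f x y = - f y x" and h: "\<And>x y. h x y = - h y x"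
    and fin: "finite C" and wx: "w \<notin> C" "x \<notin> C" "w \<noteq> x" "f w x = 0"
    and minor: "\<And>a b. f w a * f x b = f w b * f x a"
  shows "pairing_sum f h (insert w (insert x C)) = 0"
proof -
  define F where "F a b = (f w a * f x b) * (h w a * h w b) * (h a x * h x b) * h a b * h w x *
    (\<Prod>c\<in>C - {a} - {b}. h w c * h x c * (h a c * h b c)) * pairing_sum f h (C - {a} - {b})" for a b
  have "pairing_sum f h (insert w (insert x C)) =
      (\<Sum>a\<in>insert x C. f w a * h w a * (\<Prod>c\<in>insert x C - {a}. h w c * h a c) *
        pairing_sum f h (insert x C - {a}))"
    by (rule pairing_sum_insert[of f h, OF f h]) (use fin wx in auto)
  also have "\<dots> = (\<Sum>a\<in>C. f w a * h w a * (\<Prod>c\<in>insert x C - {a}. h w c * h a c) *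
        pairing_sum f h (insert x C - {a}))"
    using fin wx by simp
  also have "\<dots> = (\<Sum>a\<in>C. \<Sum>b\<in>C - {a}. F a b)"
  proof (rule sum.cong[OF refl])
    fix a assume a: "a \<in> C"
    have ins: "insert x C - {a} = insert x (C - {a})" using a wx by auto
    have "pairing_sum f h (insert x (C - {a})) =
        (\<Sum>b\<in>C - {a}. f x b * h x b * (\<Prod>c\<in>C - {a} - {b}. h x c * h b c) *
          pairing_sum f h (C - {a} - {b}))"
      by (rule pairing_sum_insert[of f h, OF f h]) (use fin wx in auto)
    \<comment> \<open>The factors of \<open>c = x\<close> and \<open>c = b\<close> are isolated so
      that the rest is indexed symmetrically in \<open>a\<close> and \<open>b\<close>.\<close>
    moreover have "(\<Prod>c\<in>insert x (C - {a}). h w c * h a c) =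
        h w x * h a x * (h w b * h a b) * (\<Prod>c\<in>C - {a} - {b}. h w c * h a c)"
      if "b \<in> C - {a}" for b
      using fin wx that prod.remove[of "C - {a}" b "\<lambda>c. h w c * h a c"] by (simp add: mult_ac)
    ultimately show "f w a * h w a * (\<Prod>c\<in>insert x C - {a}. h w c * h a c) *
        pairing_sum f h (insert x C - {a}) = (\<Sum>b\<in>C - {a}. F a b)"
      unfolding ins sum_distrib_left by (simp add: sum_distrib_left F_def prod.distrib mult_ac)
  qed
  also have "\<dots> = 0"
  proof (rule antisym_double_sum_eq_0[OF fin])
    fix a b
    have "C - {a} - {b} = C - {b} - {a}" by auto
    moreover have "h a x * h x b = h b x * h x a"
      using antisym_mult_flip[of h, OF h, where a = a and b = x and c = x and d = b]
      by (simp add: mult.commute)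
    moreover have "h a b = - h b a" by (rule h)
    ultimately show "F a b = - F b a"
      using minor[of a b] unfolding F_def by (simp add: mult.commute)
  qed
  finally show ?thesis .
qed

subsection \<open>Nonvanishing entries\<close>

text \<open>With \<open>h = 1/f\<close>, \<open>pole_sum h w B\<close> is the expansion of the Pfaffian of \<open>wB\<close> along \<open>w\<close>, all smaller
  Pfaffians being replaced by the products predicted by (i), divided by the product predicted for \<open>wB\<close>.
  Likewise \<open>residue_sum h C\<close> corresponds to the word \<open>aaC\<close> with a repeated letter.\<close>

definition pole_sum :: "('a \<Rightarrow> 'a \<Rightarrow> 'k::comm_ring_1) \<Rightarrow> 'a \<Rightarrow> 'a set \<Rightarrow> 'k" where
  "pole_sum h w B = (\<Sum>b\<in>B. \<Prod>c\<in>B - {b}. h w c * h b c)"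

definition residue_sum :: "('a \<Rightarrow> 'a \<Rightarrow> 'k::comm_ring_1) \<Rightarrow> 'a set \<Rightarrow> 'k" where
  "residue_sum h C = (\<Sum>c\<in>C. \<Prod>d\<in>C - {c}. h c d)"

section \<open>Row sums for an inverse pair of antisymmetric functions\<close>

text \<open>Each summand may be multiplied by \<open>pole_sum h a (C - {c})\<close>, which is 1. The
  terms of the resulting double sum are \<open>h c e\<close> times an expression symmetric in
  \<open>c\<close> and \<open>e\<close>.\<close>

lemma residue_sum_eq_0:
  fixes h :: "'a \<Rightarrow> 'a \<Rightarrow> 'k::comm_ring_1"
  assumes h: "\<And>x y. h x y = - h y x" and fin: "finite C"
    and one: "\<And>c. c \<in> C \<Longrightarrow> pole_sum h a (C - {c}) = 1"
  shows "residue_sum h C = 0"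
proof -
  define F where "F c e = h c e * (\<Prod>d\<in>C - {c} - {e}. h a d * (h c d * h e d))" for c e
  have "residue_sum h C = (\<Sum>c\<in>C. (\<Prod>d\<in>C - {c}. h c d) * pole_sum h a (C - {c}))"
    unfolding residue_sum_def using one by simp
  also have "\<dots> = (\<Sum>c\<in>C. \<Sum>e\<in>C - {c}. F c e)"
  proof (rule sum.cong[OF refl])
    fix c
    have "(\<Prod>d\<in>C - {c}. h c d) = h c e * (\<Prod>d\<in>C - {c} - {e}. h c d)" if "e \<in> C - {c}" for e
      using fin that prod.remove[of "C - {c}" e "h c"] by simp
    then show "(\<Prod>d\<in>C - {c}. h c d) * pole_sum h a (C - {c}) = (\<Sum>e\<in>C - {c}. F c e)"
      unfolding pole_sum_def sum_distrib_left by (simp add: F_def prod.distrib mult_ac)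
  qed
  also have "\<dots> = 0"
  proof (rule antisym_double_sum_eq_0[OF fin])
    fix c e
    have "C - {c} - {e} = C - {e} - {c}" by auto
    moreover have "h c e = - h e c" by (rule h)
    ultimately show "F c e = - F e c"
      unfolding F_def by (simp add: mult.commute)
  qed
  finally show ?thesis .
qed

text \<open>In each term on the right the factors \<open>f a c * h a c\<close> with \<open>c\<close>
  different from \<open>b\<close> cancel.\<close>

lemma sum_mult_prod_outside:
  fixes f h :: "'a \<Rightarrow> 'a \<Rightarrow> 'k::comm_ring_1"
  assumes fin: "finite B" and inv: "\<And>b. b \<in> B \<Longrightarrow> f a b * h a b = 1"
  shows "(\<Sum>b\<in>B. f a b * (\<Prod>c\<in>B - {b}. h b c)) = (\<Prod>b\<in>B. f a b) * pole_sum h a B"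
  unfolding pole_sum_def sum_distrib_left
proof (rule sum.cong[OF refl])
  fix b assume b: "b \<in> B"
  have "(\<Prod>b\<in>B. f a b) * (\<Prod>c\<in>B - {b}. h a c * h b c) =
      f a b * (\<Prod>c\<in>B - {b}. f a c * h a c) * (\<Prod>c\<in>B - {b}. h b c)"
    using prod.remove[OF fin b, of "f a"] by (simp add: prod.distrib mult_ac)
  also have "(\<Prod>c\<in>B - {b}. f a c * h a c) = 1"
    using inv by (intro prod.neutral) auto
  finally show "f a b * (\<Prod>c\<in>B - {b}. h b c) = (\<Prod>b\<in>B. f a b) * (\<Prod>c\<in>B - {b}. h a c * h b c)"
    by simp
qed

text \<open>The term \<open>b = a\<close> vanishes with \<open>f a a\<close>. In every other term
  \<open>f a b\<close> meets the factor \<open>h b a\<close>, and their product is -1.\<close>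

lemma sum_mult_prod_inside:
  fixes f h :: "'a \<Rightarrow> 'a \<Rightarrow> 'k::comm_ring_1"
  assumes h: "\<And>x y. h x y = - h y x" and fin: "finite B" and a: "a \<in> B" "f a a = 0"
    and inv: "\<And>b. b \<in> B - {a} \<Longrightarrow> f a b * h a b = 1"
  shows "(\<Sum>b\<in>B. f a b * (\<Prod>c\<in>B - {b}. h b c)) = - residue_sum h (B - {a})"
proof -
  have "(\<Sum>b\<in>B. f a b * (\<Prod>c\<in>B - {b}. h b c)) = (\<Sum>b\<in>B - {a}. f a b * (\<Prod>c\<in>B - {b}. h b c))"
    using sum.remove[OF fin a(1), of "\<lambda>b. f a b * (\<Prod>c\<in>B - {b}. h b c)"] a(2) by simp
  also have "\<dots> = (\<Sum>b\<in>B - {a}. - (\<Prod>c\<in>B - {a} - {b}. h b c))"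
  proof (rule sum.cong[OF refl])
    fix b assume b: "b \<in> B - {a}"
    have "B - {b} - {a} = B - {a} - {b}" by auto
    then have "(\<Prod>c\<in>B - {b}. h b c) = h b a * (\<Prod>c\<in>B - {a} - {b}. h b c)"
      using prod.remove[of "B - {b}" a "h b"] fin a b by auto
    moreover have "f a b * h b a = - 1"
      using inv[OF b] h[of b a] by simp
    ultimately show "f a b * (\<Prod>c\<in>B - {b}. h b c) = - (\<Prod>c\<in>B - {a} - {b}. h b c)"
      by (metis mult.assoc mult_minus1)
  qed
  finally show ?thesis by (simp add: residue_sum_def sum_negf)
qed

section \<open>Evaluation of pole sums on odd sets\<close>

text \<open>Strong induction on \<open>card B\<close>. In the double sum over \<open>A\<close> and
  \<open>B\<close>, the induction hypothesis determines every row and column sum that is used,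
  except the row of \<open>w\<close>, which contains the unknown
  \<open>pole_sum h w B\<close>.\<close>

lemma pole_sum_eq_1:
  fixes f h :: "'a \<Rightarrow> 'a \<Rightarrow> 'k::comm_ring_1"
  assumes f: "\<And>x y. f x y = - f y x" and h: "\<And>x y. h x y = - h y x"
    and diag: "\<And>x. f x x = 0"
    and inv: "\<And>x y. x \<in> X \<Longrightarrow> y \<in> X \<Longrightarrow> x \<noteq> y \<Longrightarrow> f x y * h x y = 1"
    and three: "\<And>w T. T \<subseteq> X \<Longrightarrow> w \<in> X - T \<Longrightarrow> card T = 3 \<Longrightarrow> pole_sum h w T = 1"
    and "finite B" "odd (card B)" "B \<subseteq> X" "w \<in> X - B"
  shows "pole_sum h w B = 1"
  using assms(6-)
proof (induction "card B" arbitrary: B w rule: less_induct)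
  case less
  show ?case
  proof (cases "card B = 1")
    case True
    then show ?thesis by (auto simp: card_1_singleton_iff pole_sum_def)
  next
    case False
    with \<open>odd (card B)\<close> have card3: "3 \<le> card B" by presburger
    then obtain T where T: "T \<subseteq> B" "card T = 3" "finite T"
      by (rule obtain_subset_with_card_n)
    define \<alpha> where "\<alpha> = B - T"
    define A where "A = insert w \<alpha>"
    have fin: "finite \<alpha>" "finite A" "finite B" using less.prems by (auto simp: \<alpha>_def A_def)
    have B: "B = \<alpha> \<union> T" "\<alpha> \<inter> T = {}" using T by (auto simp: \<alpha>_def)
    have w: "w \<notin> \<alpha>" "w \<notin> B" "w \<notin> T" "w \<in> X" using less.prems T by (auto simp: \<alpha>_def)
    have sub: "\<alpha> \<subseteq> X" "A \<subseteq> X" "T \<subseteq> X" "B \<subseteq> X" using less.prems T by (auto simp: A_def \<alpha>_def)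
    have "card B = card \<alpha> + 3" using B fin T by (metis card_Un_disjoint)
    then have cardA: "card A + 2 = card B" using fin w by (simp add: A_def)
    \<comment> \<open>Size \<open>card B - 2\<close> occurs for \<open>A\<close> itself and for
      \<open>B\<close> with two elements deleted, size \<open>card B - 4\<close> for
      \<open>A\<close> with two elements deleted.\<close>
    have IH: "pole_sum h v C = 1"
      if "card C + 2 = card B \<or> card C + 4 = card B" "finite C" "C \<subseteq> X" "v \<in> X - C" for v C
    proof (rule less.hyps)
      show "card C < card B" using that(1) by auto
      show "odd (card C)" using that(1) less.prems(2) by presburger
    qed (use that in auto)
    define p where "p a = (\<Prod>c\<in>A - {a}. h a c)" for a
    define q where "q b = (\<Prod>c\<in>B - {b}. h b c)" for b

    \<comment> \<open>A letter of the common part \<alpha> lies in \<open>B\<close>, so its row is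
      minus a residue sum, which vanishes by induction.\<close>
    have rowB: "(\<Sum>b\<in>B. f a b * q b) = 0" if a: "a \<in> \<alpha>" for a
    proof -
      have aB: "a \<in> B" "a \<in> X" using a B sub by auto
      have "residue_sum h (B - {a}) = 0"
      proof (rule residue_sum_eq_0[of h, OF h, where a = a])
        fix c assume c: "c \<in> B - {a}"
        have "card (B - {a} - {c}) + 2 = card B"
          using aB c fin card3 by (simp add: card_Diff_singleton_if)
        then show "pole_sum h a (B - {a} - {c}) = 1"
          using sub aB fin by (intro IH) auto
      qed (use fin in simp)
      moreover have "f a c * h a c = 1" if "c \<in> B - {a}" for c
        using that aB sub by (intro inv) auto
      ultimately show ?thesis
        unfolding q_def using sum_mult_prod_inside[of h B a f, OF h fin(3) aB(1) diag] by simp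
    qed
    have rowA: "(\<Sum>a\<in>A. f b a * p a) = 0" if b: "b \<in> \<alpha>" for b
    proof -
      have bA: "b \<in> A" "b \<in> X" using b sub by (auto simp: A_def)
      have "residue_sum h (A - {b}) = 0"
      proof (rule residue_sum_eq_0[of h, OF h, where a = b])
        fix c assume c: "c \<in> A - {b}"
        have "card {b, c} \<le> card A" by (rule card_mono) (use c bA fin in auto)
        then have "card (A - {b} - {c}) + 2 = card A"
          using bA c fin by (auto simp: card_Diff_singleton_if card_insert_if)
        then show "pole_sum h b (A - {b} - {c}) = 1"
          using bA sub cardA fin by (intro IH) auto
      qed (use fin in simp)
      moreover have "f b c * h b c = 1" if "c \<in> A - {b}" for c
        using that bA sub by (intro inv) auto
      ultimately show ?thesis
        unfolding p_def using sum_mult_prod_inside[of h A b f, OF h fin(2) bA(1) diag] by simp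
    qed
    have colw: "(\<Sum>b\<in>B. f w b * q b) = (\<Prod>b\<in>B. f w b) * pole_sum h w B"
      unfolding q_def by (rule sum_mult_prod_outside[OF fin(3)], rule inv) (use w sub in auto)
    have colb: "(\<Sum>a\<in>A. f b a * p a) = (\<Prod>a\<in>A. f b a)" if b: "b \<in> T" for b
    proof -
      have bA: "b \<notin> A" "b \<in> X" using b w B sub by (auto simp: A_def)
      have "pole_sum h b A = 1"
        using bA sub cardA fin by (intro IH) auto
      moreover have "(\<Sum>a\<in>A. f b a * p a) = (\<Prod>a\<in>A. f b a) * pole_sum h b A"
        unfolding p_def by (rule sum_mult_prod_outside[OF fin(2)], rule inv) (use bA sub in auto)
      ultimately show ?thesis by simp
    qed

    \<comment> \<open>Removes the common part \<alpha> from both evaluations, once for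
      \<open>w\<close> and once for each letter of \<open>T\<close>.\<close>
    have cancel: "(\<Prod>a\<in>\<alpha>. h b a) * (\<Prod>a\<in>\<alpha>. f b a) = 1" if "b \<in> X - \<alpha>" for b
    proof -
      have "f b a * h b a = 1" if "a \<in> \<alpha>" for a using that \<open>b \<in> X - \<alpha>\<close> sub by (intro inv) auto
      then have "(\<Prod>a\<in>\<alpha>. f b a * h b a) = 1" by (simp add: prod.neutral)
      then show ?thesis by (simp add: prod.distrib mult.commute)
    qed

    have "(\<Sum>a\<in>A. p a * (\<Sum>b\<in>B. f a b * q b)) = p w * (\<Sum>b\<in>B. f w b * q b)"
      using fin w rowB by (simp add: A_def)
    also have "\<dots> = (\<Prod>a\<in>\<alpha>. h w a) * (\<Prod>a\<in>\<alpha>. f w a) * (\<Prod>b\<in>T. f w b) * pole_sum h w B"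
    proof -
      have "A - {w} = \<alpha>" using w by (auto simp: A_def)
      moreover have "(\<Prod>b\<in>B. f w b) = (\<Prod>a\<in>\<alpha>. f w a) * (\<Prod>b\<in>T. f w b)"
        unfolding B(1) by (rule prod.union_disjoint) (use fin T B in auto)
      ultimately show ?thesis unfolding colw p_def by (simp add: mult.assoc)
    qed
    also have "\<dots> = (\<Prod>b\<in>T. f w b) * pole_sum h w B"
      using cancel[of w] w by simp
    finally have D1: "(\<Sum>a\<in>A. p a * (\<Sum>b\<in>B. f a b * q b)) = (\<Prod>b\<in>T. f w b) * pole_sum h w B" .

    \<comment> \<open>Now sum by columns; writing \<open>f a b\<close> as \<open>- f b a\<close>
      brings each column into the form of \<open>rowA\<close> and \<open>colb\<close>.\<close>
    have "(\<Sum>a\<in>A. p a * (\<Sum>b\<in>B. f a b * q b)) = (\<Sum>a\<in>A. \<Sum>b\<in>B. - (q b * (f b a * p a)))"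
      unfolding sum_distrib_left
    proof (intro sum.cong refl)
      fix a b show "p a * (f a b * q b) = - (q b * (f b a * p a))"
        using f[of a b] by (simp add: mult_ac)
    qed
    also have "\<dots> = (\<Sum>b\<in>B. - (q b * (\<Sum>a\<in>A. f b a * p a)))"
      by (subst sum.swap) (simp add: sum_distrib_left sum_negf)
    also have "\<dots> = (\<Sum>b\<in>T. - (q b * (\<Sum>a\<in>A. f b a * p a)))"
      unfolding B(1) using fin T B(2) rowA by (subst sum.union_disjoint) auto
    also have "\<dots> = (\<Sum>b\<in>T. f w b * (\<Prod>c\<in>T - {b}. h b c))"
    proof (rule sum.cong[OF refl])
      fix b assume b: "b \<in> T"
      have "B - {b} = \<alpha> \<union> (T - {b})" using b B by auto
      then have q: "q b = (\<Prod>a\<in>\<alpha>. h b a) * (\<Prod>c\<in>T - {b}. h b c)"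
        unfolding q_def using fin T B(2) by (simp add: prod.union_disjoint disjoint_iff)
      have "(\<Prod>a\<in>A. f b a) = f b w * (\<Prod>a\<in>\<alpha>. f b a)"
        unfolding A_def using fin w by simp
      then have "q b * (\<Prod>a\<in>A. f b a) =
          f b w * (\<Prod>c\<in>T - {b}. h b c) * ((\<Prod>a\<in>\<alpha>. h b a) * (\<Prod>a\<in>\<alpha>. f b a))"
        using q by (simp add: mult_ac)
      also have "(\<Prod>a\<in>\<alpha>. h b a) * (\<Prod>a\<in>\<alpha>. f b a) = 1"
        by (rule cancel) (use b sub B in auto)
      finally show "- (q b * (\<Sum>a\<in>A. f b a * p a)) = f w b * (\<Prod>c\<in>T - {b}. h b c)"
        unfolding colb[OF b] using f[of w b] by simp
    qed
    also have "\<dots> = (\<Prod>b\<in>T. f w b) * pole_sum h w T"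
      by (rule sum_mult_prod_outside[OF T(3)], rule inv) (use w sub in auto)
    also have "pole_sum h w T = 1" using three T w sub by auto
    finally have "(\<Prod>b\<in>T. f w b) * pole_sum h w B = (\<Prod>b\<in>T. f w b)"
      using D1 by simp
    \<comment> \<open>The ring may have zero divisors, so the common factor is cancelled through an
      explicit inverse.\<close>
    moreover have "(\<Prod>b\<in>T. h w b) * (\<Prod>b\<in>T. f w b) = 1"
    proof -
      have "f w b * h w b = 1" if "b \<in> T" for b using that w sub by (intro inv) auto
      then have "(\<Prod>b\<in>T. f w b * h w b) = 1" by (simp add: prod.neutral)
      then show ?thesis by (simp add: prod.distrib mult.commute)
    qed
    ultimately show ?thesis by (metis mult.assoc mult_1)
  qed
qed

text \<open>Expand along any letter \<open>w\<close>: the smaller sums are 1 by induction and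
  \<open>f w b * h w b = 1\<close>, so a pole sum at \<open>w\<close> remains.\<close>

lemma pairing_sum_eq_1:
  fixes f h :: "'a \<Rightarrow> 'a \<Rightarrow> 'k::comm_ring_1"
  assumes f: "\<And>x y. f x y = - f y x" and h: "\<And>x y. h x y = - h y x"
    and inv: "\<And>x y. x \<in> X \<Longrightarrow> y \<in> X \<Longrightarrow> x \<noteq> y \<Longrightarrow> f x y * h x y = 1"
    and one: "\<And>w B. B \<subseteq> X \<Longrightarrow> w \<in> X - B \<Longrightarrow> odd (card B) \<Longrightarrow> pole_sum h w B = 1"
    and "finite S" "even (card S)" "S \<subseteq> X"
  shows "pairing_sum f h S = 1"
  using assms(5-)
proof (induction "card S" arbitrary: S rule: less_induct)
  case less
  show ?case
  proof (cases "S = {}")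
    case True
    then show ?thesis by (simp add: pairing_sum_empty)
  next
    case False
    then obtain w B where S: "S = insert w B" "w \<notin> B" by (metis ex_in_conv mk_disjoint_insert)
    have B: "finite B" "odd (card B)" "B \<subseteq> X" "w \<in> X - B" "card S = Suc (card B)"
      using less.prems S by auto
    have "pairing_sum f h S =
        (\<Sum>b\<in>B. f w b * h w b * (\<Prod>c\<in>B - {b}. h w c * h b c) * pairing_sum f h (B - {b}))"
      unfolding S(1) by (rule pairing_sum_insert[of f h, OF f h B(1) S(2)])
    also have "\<dots> = (\<Sum>b\<in>B. \<Prod>c\<in>B - {b}. h w c * h b c)"
    proof (rule sum.cong[OF refl])
      fix b assume b: "b \<in> B"
      then have c: "Suc (card (B - {b})) = card B" using B(1) by (rule card_Suc_Diff1[rotated])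
      have "pairing_sum f h (B - {b}) = 1"
      proof (rule less.hyps)
        show "even (card (B - {b}))" using c B(2) by presburger
      qed (use c B in auto)
      moreover have "f w b * h w b = 1" using b B by (intro inv) auto
      ultimately show "f w b * h w b * (\<Prod>c\<in>B - {b}. h w c * h b c) * pairing_sum f h (B - {b})
          = (\<Prod>c\<in>B - {b}. h w c * h b c)" by simp
    qed
    also have "\<dots> = 1" using one[of B w] B by (simp add: pole_sum_def)
    finally show ?thesis .
  qed
qed

subsection \<open>The product formula\<close>

lemma to_fract_of_int: "to_fract (of_int n) = (of_int n :: 'k::idom fract)"
proof -
  have nat: "to_fract (of_nat m) = (of_nat m :: 'k fract)" for m
    by (induction m) simp_all
  show ?thesis by (cases n rule: int_cases2) (simp_all add: nat)
qed

lemma to_fract_prod: "to_fract (prod g A) = (\<Prod>x\<in>A. to_fract (g x))"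
  by (induction A rule: infinite_finite_induct) simp_all

lemma to_fract_sum: "to_fract (sum g A) = (\<Sum>x\<in>A. to_fract (g x))"
  by (induction A rule: infinite_finite_induct) simp_all

lemma to_fract_pfaff: "to_fract (pfaff f xs) = pfaff (\<lambda>x y. to_fract (f x y)) xs"
  by (simp add: pfaff_def pf_summand_def to_fract_sum to_fract_prod to_fract_of_int)

lemma to_fract_prod_ordered:
  "to_fract (prod_ordered f xs) = prod_ordered (\<lambda>x y. to_fract (f x y)) xs"
  by (simp add: prod_ordered_conv_prod to_fract_prod case_prod_unfold)

lemma prod_ordered_inverse:
  fixes f :: "'a \<Rightarrow> 'a \<Rightarrow> 'k::field"
  assumes "distinct xs" "\<And>x y. x \<in> set xs \<Longrightarrow> y \<in> set xs \<Longrightarrow> x \<noteq> y \<Longrightarrow> f x y \<noteq> 0"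
  shows "prod_ordered (\<lambda>x y. inverse (f x y)) xs * prod_ordered f xs = 1"
  using assms
proof (induction xs)
  case (Cons x xs)
  have "(\<Prod>y\<leftarrow>xs. inverse (f x y) * f x y) = 1"
    using Cons.prems by (induction xs) auto
  then have "(\<Prod>y\<leftarrow>xs. inverse (f x y)) * (\<Prod>y\<leftarrow>xs. f x y) = 1"
    by (simp only: prod_list_mult_distrib)
  moreover have "prod_ordered (\<lambda>x y. inverse (f x y)) xs * prod_ordered f xs = 1"
    using Cons by simp
  moreover have "prod_ordered (\<lambda>x y. inverse (f x y)) (x # xs) * prod_ordered f (x # xs) =
      ((\<Prod>y\<leftarrow>xs. inverse (f x y)) * (\<Prod>y\<leftarrow>xs. f x y)) *
      (prod_ordered (\<lambda>x y. inverse (f x y)) xs * prod_ordered f xs)"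
    by (simp only: prod_ordered.simps mult_ac)
  ultimately show ?case by simp
qed simp

text \<open>For \<open>h = 1/f\<close> the pairing sum is 1, so the Pfaffian and
  \<open>prod_ordered f xs\<close> are both inverse to \<open>prod_ordered h xs\<close>.\<close>

lemma pfaff_eq_prod_ordered_field:
  fixes f :: "'a \<Rightarrow> 'a \<Rightarrow> 'k::field"
  assumes f: "\<And>x y. f x y = - f y x" and diag: "\<And>x. f x x = 0"
    and four: "\<And>w x y z. f w x * f y z - f w y * f x z + f w z * f x y =
      f w x * f w y * f w z * f x y * f x z * f y z"
    and xs: "distinct xs" "even (length xs)"
    and nz: "\<And>x y. x \<in> set xs \<Longrightarrow> y \<in> set xs \<Longrightarrow> x \<noteq> y \<Longrightarrow> f x y \<noteq> 0"
  shows "pfaff f xs = prod_ordered f xs"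
proof -
  define h where "h x y = inverse (f x y)" for x y
  \<comment> \<open>Holds at zeros of \<open>f\<close> as well, in particular on the diagonal,
    because \<open>inverse 0 = 0\<close>.\<close>
  have h: "h x y = - h y x" for x y
    unfolding h_def using f[of x y] by (metis inverse_minus_eq)
  have inv: "f x y * h x y = 1" if "x \<in> set xs" "y \<in> set xs" "x \<noteq> y" for x y
    using nz[OF that] by (simp add: h_def)
  \<comment> \<open>This is (ii) divided by its right-hand side, all of whose factors are nonzero
    here.\<close>
  have three: "pole_sum h w T = 1" if T: "T \<subseteq> set xs" "w \<in> set xs - T" "card T = 3" for w T
  proof -
    obtain x y z where xyz: "T = {x, y, z}" "x \<noteq> y" "x \<noteq> z" "y \<noteq> z"
      using T(3) by (auto simp: card_3_iff)
    have ne: "f w x \<noteq> 0" "f w y \<noteq> 0" "f w z \<noteq> 0" "f x y \<noteq> 0" "f x z \<noteq> 0" "f y z \<noteq> 0"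
      using T xyz nz by auto
    have D: "{x, y, z} - {x} = {y, z}" "{x, y, z} - {y} = {x, z}" "{x, y, z} - {z} = {x, y}"
      using xyz by auto
    have "pole_sum h w T = (h w y * h x y) * (h w z * h x z) +
        ((h w x * h y x) * (h w z * h y z) + (h w x * h z x) * (h w y * h z y))"
      unfolding xyz(1) pole_sum_def using xyz(2-) by (simp add: D del: insert_Diff_single)
    also have "\<dots> = h w y * h x y * h w z * h x z - h w x * h x y * h w z * h y z
        + h w x * h x z * h w y * h y z"
      using h[of y x] h[of z x] h[of z y] by simp
    also have "\<dots> = (f w x * f y z - f w y * f x z + f w z * f x y) /
        (f w x * f w y * f w z * f x y * f x z * f y z)"
      unfolding h_def using ne by (simp add: field_simps)
    also have "\<dots> = 1" unfolding four using ne by simp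
    finally show ?thesis .
  qed
  have one: "pole_sum h w B = 1" if "B \<subseteq> set xs" "w \<in> set xs - B" "odd (card B)" for w B
    by (rule pole_sum_eq_1[of f h "set xs", OF f h diag inv three])
      (use that finite_subset in auto)
  have "pairing_sum f h (set xs) = 1"
    by (rule pairing_sum_eq_1[of f h "set xs", OF f h inv one])
      (use xs in \<open>auto simp: distinct_card\<close>)
  then have "prod_ordered h xs * pfaff f xs = 1"
    using prod_ordered_mult_pfaff[of h, OF h xs(1)] by simp
  moreover have "prod_ordered h xs * prod_ordered f xs = 1"
    using prod_ordered_inverse[of xs f, OF xs(1) nz] unfolding h_def by blast
  ultimately show ?thesis
    by (metis mult_left_cancel mult_zero_left zero_neq_one)
qed

section \<open>The product formula over an integral domain\<close>

text \<open>Antisymmetric and equal to 1 on pairs in the order of a distinct word \<open>xs\<close>,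
  so its ordered product over \<open>xs\<close> is 1. It makes the Pfaffian itself a pairing sum
  without inverting \<open>f\<close>.\<close>

definition order_sign :: "'a list \<Rightarrow> 'a \<Rightarrow> 'a \<Rightarrow> 'k::comm_ring_1" where
  "order_sign xs x y =
    (if pos xs x < pos xs y then 1 else if pos xs y < pos xs x then - 1 else 0)"

lemma order_sign_antisym: "order_sign xs x y = - order_sign xs y x"
  by (simp add: order_sign_def)

lemma pfaff_eq_pairing_sum:
  fixes f :: "'a \<Rightarrow> 'a \<Rightarrow> 'k::comm_ring_1"
  assumes "distinct xs"
  shows "pfaff f xs = pairing_sum f (order_sign xs) (set xs)"
proof -
  have "prod_ordered (order_sign xs) xs = (1 :: 'k)"
    unfolding prod_ordered_conv_prod
    by (rule prod.neutral) (auto simp: order_sign_def pos_nth[OF assms])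
  then show ?thesis
    using prod_ordered_mult_pfaff[of "order_sign xs" xs f, OF order_sign_antisym assms] by simp
qed

lemma prod_ordered_eq_0:
  fixes f :: "'a \<Rightarrow> 'a \<Rightarrow> 'k::comm_ring_1"
  assumes "i < j" "j < length xs" "f (xs ! i) (xs ! j) = 0"
  shows "prod_ordered f xs = 0"
proof -
  have "finite {(i, j). i < j \<and> j < length xs}"
    by (rule finite_subset[of _ "{..<length xs} \<times> {..<length xs}"]) auto
  then show ?thesis
    unfolding prod_ordered_conv_prod using assms by (intro prod_zero) auto
qed

text \<open>With a repeated letter both sides are 0. If an entry at two distinct letters is 0, so
  are the product and, by the vanishing minors, the Pfaffian. Otherwise the fraction field
  applies.\<close>

lemma pfaff_eq_prod_ordered:
  fixes f :: "'a \<Rightarrow> 'a \<Rightarrow> 'k::idom"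
  assumes f: "\<And>x y. f x y = - f y x" and diag: "\<And>x. f x x = 0"
    and four: "\<And>w x y z. f w x * f y z - f w y * f x z + f w z * f x y =
      f w x * f w y * f w z * f x y * f x z * f y z"
    and even: "even (length xs)"
  shows "pfaff f xs = prod_ordered f xs"
proof (cases "distinct xs")
  case False
  then obtain i j where "i < j" "j < length xs" "xs ! i = xs ! j"
    by (metis distinct_conv_nth linorder_neqE_nat)
  then have "prod_ordered f xs = 0" using diag by (intro prod_ordered_eq_0) auto
  then show ?thesis using False by (simp add: pfaff_def)
next
  case True
  show ?thesis
  proof (cases "\<exists>w\<in>set xs. \<exists>x\<in>set xs. w \<noteq> x \<and> f w x = 0")
    case True
    then obtain w x where wx: "w \<in> set xs" "x \<in> set xs" "w \<noteq> x" "f w x = 0" by blast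
    \<comment> \<open>For \<open>f w x = 0\<close> the right-hand side of (ii) vanishes, and the
      left-hand side is, up to sign, a minor of the rows of \<open>w\<close> and
      \<open>x\<close>.\<close>
    have "f w a * f x b = f w b * f x a" for a b
      using four[of w x a b] wx(4) by simp
    then have "pairing_sum f (order_sign xs) (insert w (insert x (set xs - {w, x}))) = 0"
      using wx by (intro pairing_sum_eq_0[of f] f order_sign_antisym) auto
    moreover have "insert w (insert x (set xs - {w, x})) = set xs" using wx by auto
    ultimately have "pfaff f xs = 0" using pfaff_eq_pairing_sum[OF \<open>distinct xs\<close>, of f] by simp
    moreover obtain i j where ij: "i < length xs" "j < length xs" "xs ! i = w" "xs ! j = x"
      using wx by (metis in_set_conv_nth)
    \<comment> \<open>Needed because \<open>w\<close> and \<open>x\<close> may occur in either order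
      in \<open>xs\<close>.\<close>
    have "f x w = 0" using f[of x w] wx by simp
    then have "prod_ordered f xs = 0"
      using prod_ordered_eq_0[of i j xs f] prod_ordered_eq_0[of j i xs f] ij wx
      by (metis linorder_neqE_nat)
    ultimately show ?thesis by simp
  next
    case False
    have "to_fract (pfaff f xs) = to_fract (prod_ordered f xs)"
      unfolding to_fract_pfaff to_fract_prod_ordered
    proof (rule pfaff_eq_prod_ordered_field)
      show "to_fract (f x y) = - to_fract (f y x)" for x y
        using f[of x y] by (metis to_fract_uminus)
      show "to_fract (f w x) * to_fract (f y z) - to_fract (f w y) * to_fract (f x z) +
        to_fract (f w z) * to_fract (f x y) = to_fract (f w x) * to_fract (f w y) *
        to_fract (f w z) * to_fract (f x y) * to_fract (f x z) * to_fract (f y z)" for w x y z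
        using four[of w x y z] by (metis to_fract_add to_fract_diff to_fract_mult)
    qed (use False diag even \<open>distinct xs\<close> in auto)
    then show ?thesis by simp
  qed
qed

section \<open>Four letters and the equivalence\<close>

lemma pairing_sum_pair:
  fixes f h :: "'a \<Rightarrow> 'a \<Rightarrow> 'k::comm_ring_1"
  assumes "\<And>x y. f x y = - f y x" "\<And>x y. h x y = - h y x" "y \<noteq> z"
  shows "pairing_sum f h {y, z} = f y z * h y z"
  using pairing_sum_insert[of f h "{z}" y, OF assms(1,2)] assms(3) by (simp add: pairing_sum_empty)

text \<open>Expansion along \<open>w\<close> with weight \<open>order_sign\<close>. For the partner
  \<open>y\<close> the factor \<open>h y x = - 1\<close> gives the minus sign; for \<open>z\<close>
  the signs of \<open>h z x\<close> and \<open>h z y\<close> cancel.\<close>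

lemma pfaff_four:
  fixes f :: "'a \<Rightarrow> 'a \<Rightarrow> 'k::comm_ring_1"
  assumes f: "\<And>x y. f x y = - f y x" and d: "distinct [w, x, y, z]"
  shows "pfaff f [w, x, y, z] = f w x * f y z - f w y * f x z + f w z * f x y"
proof -
  define h :: "'a \<Rightarrow> 'a \<Rightarrow> 'k" where "h = order_sign [w, x, y, z]"
  have h: "h a b = - h b a" for a b unfolding h_def by (rule order_sign_antisym)
  have pos: "pos [w, x, y, z] w = 0" "pos [w, x, y, z] x = 1"
    "pos [w, x, y, z] y = 2" "pos [w, x, y, z] z = 3"
    using pos_nth[OF d, of 0] pos_nth[OF d, of 1] pos_nth[OF d, of 2] pos_nth[OF d, of 3] by auto
  then have hv: "h w x = 1" "h w y = 1" "h w z = 1" "h x y = 1" "h x z = 1" "h y z = 1"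
    "h y x = - 1" "h z x = - 1" "h z y = - 1"
    by (simp_all add: h_def order_sign_def)
  have D: "{x, y, z} - {x} = {y, z}" "{x, y, z} - {y} = {x, z}" "{x, y, z} - {z} = {x, y}"
    using d by auto
  have "pairing_sum f h {w, x, y, z} = (\<Sum>b\<in>{x, y, z}. f w b * h w b *
      (\<Prod>c\<in>{x, y, z} - {b}. h w c * h b c) * pairing_sum f h ({x, y, z} - {b}))"
    by (rule pairing_sum_insert[of f h, OF f h]) (use d in auto)
  also have "\<dots> = f w x * f y z - f w y * f x z + f w z * f x y"
    using d by (simp add: D hv pairing_sum_pair[of f h, OF f h] del: insert_Diff_single)
  finally show ?thesis
    using pfaff_eq_pairing_sum[OF d, of f] by (simp add: h_def)
qed

theorem mainTheorem10:
  fixes f :: "'a \<Rightarrow> 'a \<Rightarrow> 'k::idom"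
  assumes antisym: "\<forall>x y. f x y = - f y x"
    and diag: "\<forall>x. f x x = 0"
  shows "(\<forall>xs :: 'a list. even (length xs) \<longrightarrow>
            pfaff f xs = (\<Prod>(i, j)\<in>{(i, j). i < j \<and> j < length xs}. f (xs ! i) (xs ! j)))
         \<longleftrightarrow>
         (\<forall>w x y z. f w x * f y z - f w y * f x z + f w z * f x y =
                     f w x * f w y * f w z * f x y * f x z * f y z)"
proof
  assume prod: "\<forall>xs :: 'a list. even (length xs) \<longrightarrow>
    pfaff f xs = (\<Prod>(i, j)\<in>{(i, j). i < j \<and> j < length xs}. f (xs ! i) (xs ! j))"
  show "\<forall>w x y z. f w x * f y z - f w y * f x z + f w z * f x y =
    f w x * f w y * f w z * f x y * f x z * f y z"
  proof (intro allI)
    fix w x y z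
    show "f w x * f y z - f w y * f x z + f w z * f x y =
      f w x * f w y * f w z * f x y * f x z * f y z"
    proof (cases "distinct [w, x, y, z]")
      case True
      have "pfaff f [w, x, y, z] = prod_ordered f [w, x, y, z]"
        unfolding prod_ordered_conv_prod using prod by simp
      moreover have "pfaff f [w, x, y, z] = f w x * f y z - f w y * f x z + f w z * f x y"
        by (rule pfaff_four[OF _ True]) (use antisym in blast)
      ultimately show ?thesis by (simp add: mult_ac)
    next
      case False
      \<comment> \<open>With a repeated letter \<open>pfaff\<close> is 0 by convention, so (i) says
        nothing about the left-hand side of (ii). Antisymmetry and the zero diagonal make both sides
        0.\<close>
      have "f x w = - f w x" "f y w = - f w y" "f z w = - f w z"
        "f y x = - f x y" "f z x = - f x z" "f z y = - f y z"
        using antisym by blast+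
      with False diag show ?thesis by (auto simp: mult.commute)
    qed
  qed
next
  assume four: "\<forall>w x y z. f w x * f y z - f w y * f x z + f w z * f x y =
    f w x * f w y * f w z * f x y * f x z * f y z"
  have "pfaff f xs = prod_ordered f xs" if "even (length xs)" for xs
    using antisym diag four that by (intro pfaff_eq_prod_ordered) blast+
  then show "\<forall>xs :: 'a list. even (length xs) \<longrightarrow>
    pfaff f xs = (\<Prod>(i, j)\<in>{(i, j). i < j \<and> j < length xs}. f (xs ! i) (xs ! j))"
    unfolding prod_ordered_conv_prod by blast
qed

end
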